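(* For every integer $r \ge 2$ there is a constant $b_r > 0$, depending only on $r$, such that for every positive integer $d$ there are infinitely many integers $n$ for which there exists an $(r+1)$-graph $H_n$ on $n$ vertices with maximum $r$-degree $d$ satisfying $$\alpha(H_n) \ \le\ b_r \Bigl(\frac{n}{d}\log \frac{n}{d}\Bigr)^{1/r}.$$
   Context: An $(r+1)$-graph is a hypergraph on a finite vertex set all of whose edges are $(r+1)$-element subsets of the vertex set. The maximum $r$-degree of an $(r+1)$-graph $H$ is the maximum, over all $r$-element sets $R$ of vertices, of the number of edges of $H$ containing $R$. An independent set in $H$ is a set of vertices containing no edge of $H$, and $\alpha(H)$ is the maximum size of an independent set in $H$. All logarithms are natural. *)

theory Defs
  imports Complex_Main
begin

definition uniform_hypergraph :: "nat \<Rightarrow> 'a set \<Rightarrow> 'a set set \<Rightarrow> bool" where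
  "uniform_hypergraph k V E \<longleftrightarrow> finite V \<and> (\<forall>e\<in>E. e \<subseteq> V \<and> card e = k)"

definition degree :: "'a set set \<Rightarrow> 'a set \<Rightarrow> nat" where
  "degree E R = card {e \<in> E. R \<subseteq> e}"

text \<open>The value is unspecified when \<open>card V < r\<close>, where there are no \<open>r\<close>-element vertex sets.\<close>

definition max_degree :: "nat \<Rightarrow> 'a set \<Rightarrow> 'a set set \<Rightarrow> nat" where
  "max_degree r V E = Max {degree E R | R. R \<subseteq> V \<and> card R = r}"

definition independent_set :: "'a set \<Rightarrow> 'a set set \<Rightarrow> 'a set \<Rightarrow> bool" where
  "independent_set V E I \<longleftrightarrow> I \<subseteq> V \<and> (\<forall>e\<in>E. \<not> e \<subseteq> I)"

definition independence_number :: "'a set \<Rightarrow> 'a set set \<Rightarrow> nat" where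
  "independence_number V E = Max {card I | I. independent_set V E I}"

end

theory Submission
  imports Defs "HOL-Real_Asymp.Real_Asymp"
begin

text \<open>
  Offer \<open>T\<close>, a small constant times \<open>d n\<^sup>r\<close>, random \<open>(r + 1)\<close>-sets one after the other, and accept
  each one that keeps all \<open>r\<close>-degrees at most \<open>d\<close>. Fix a vertex set \<open>S\<close> of size \<open>s\<close>, where
  \<open>s\<^sup>r \<ge> C (n / d) ln n\<close>. An \<open>r\<close>-subset of \<open>S\<close> of degree \<open>d\<close> uses up \<open>d\<close> edges that meet \<open>S\<close> in at
  least \<open>r\<close> points. As long as the number \<open>X\<close> of such edges is below a threshold \<open>M\<close> of order
  \<open>d s\<^sup>r\<close>, at least half of the \<open>(r + 1)\<close>-subsets of \<open>S\<close> would still be accepted, so \<open>S\<close> stays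
  independent for all \<open>T\<close> steps with probability at most \<open>exp (- p T)\<close>, which beats the number of
  choices of \<open>S\<close>. The expectation of \<open>2 ^ X\<close> is at most \<open>exp (q T)\<close>, so \<open>X > M\<close> is even less likely.
  The union bound over \<open>S\<close> is run as a potential function that some offered set does not increase.
  Finally, a maximal hypergraph with \<open>r\<close>-degrees at most \<open>d\<close> attains degree \<open>d\<close>, and adding edges
  does not create independent sets.
\<close>

section \<open>Degree bounds, saturated sets and blocked edges\<close>

text \<open>\<open>R\<close> ranges over the whole type, so no vertex set has to be carried along:
  when all edges lie in \<open>V\<close>, a set \<open>R\<close> not inside \<open>V\<close> has
  degree 0.\<close>

definition degree_bounded :: "nat \<Rightarrow> nat \<Rightarrow> 'a set set \<Rightarrow> bool" where
  "degree_bounded r d E \<longleftrightarrow> (\<forall>R. card R = r \<longrightarrow> degree E R \<le> d)"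

text \<open>For finite edges these are the edges that contain some \<open>r\<close>-subset of
  \<open>S\<close>, hence the only ones that count towards the degree of such a subset.\<close>

definition near_edges :: "nat \<Rightarrow> 'a set \<Rightarrow> 'a set set \<Rightarrow> 'a set set" where
  "near_edges r S E = {e \<in> E. r \<le> card (e \<inter> S)}"

definition saturated :: "nat \<Rightarrow> nat \<Rightarrow> 'a set \<Rightarrow> 'a set set \<Rightarrow> 'a set set" where
  "saturated r d S E = {R. R \<subseteq> S \<and> card R = r \<and> d \<le> degree E R}"

definition greedy_step :: "nat \<Rightarrow> nat \<Rightarrow> 'a set \<Rightarrow> 'a set set \<Rightarrow> 'a set set" where
  "greedy_step r d e E = (if degree_bounded r d (insert e E) then insert e E else E)"

lemma degree_insert_le:
  assumes "finite E"
  shows "degree (insert e E) R \<le> degree E R + 1"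
proof -
  have "{f \<in> insert e E. R \<subseteq> f} \<subseteq> insert e {f \<in> E. R \<subseteq> f}" by auto
  then have "degree (insert e E) R \<le> card (insert e {f \<in> E. R \<subseteq> f})"
    unfolding degree_def using assms by (intro card_mono) auto
  then show ?thesis
    using assms by (simp add: degree_def card_insert_if split: if_splits)
qed

lemma degree_insert_not_subset:
  assumes "\<not> R \<subseteq> e"
  shows "degree (insert e E) R = degree E R"
proof -
  have "{f \<in> insert e E. R \<subseteq> f} = {f \<in> E. R \<subseteq> f}" using assms by auto
  then show ?thesis by (simp add: degree_def)
qed

text \<open>Double counting of pairs of a saturated \<open>R\<close> and an edge containing it: each
  \<open>R\<close> lies in at least \<open>d\<close> edges, while an edge has only
  \<open>r + 1\<close> subsets of size \<open>r\<close>, none of them inside \<open>S\<close> unless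
  the edge is near \<open>S\<close>.\<close>

lemma card_saturated:
  assumes "finite E" "finite S" and E: "\<And>e. e \<in> E \<Longrightarrow> card e = r + 1"
  shows "d * card (saturated r d S E) \<le> (r + 1) * card (near_edges r S E)"
proof -
  let ?Z = "saturated r d S E"
  have fZ: "finite ?Z"
    using \<open>finite S\<close> by (auto simp: saturated_def intro: finite_subset[of _ "Pow S"])
  have le: "card {R \<in> ?Z. R \<subseteq> e} \<le> (if r \<le> card (e \<inter> S) then r + 1 else 0)" if "e \<in> E" for e
  proof -
    have fe: "finite e"
      using E[OF that] card.infinite by fastforce
    have "card {R. R \<subseteq> e \<and> card R = r} = r + 1"
      using n_subsets[OF fe, of r] E[OF that] by simp
    moreover have "{R \<in> ?Z. R \<subseteq> e} \<subseteq> {R. R \<subseteq> e \<and> card R = r}"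
      by (auto simp: saturated_def)
    moreover have "finite {R. R \<subseteq> e \<and> card R = r}"
      using fe by simp
    ultimately have 1: "card {R \<in> ?Z. R \<subseteq> e} \<le> r + 1"
      using card_mono[of "{R. R \<subseteq> e \<and> card R = r}" "{R \<in> ?Z. R \<subseteq> e}"] by linarith
    show ?thesis
    proof (cases "r \<le> card (e \<inter> S)")
      case True
      with 1 show ?thesis by (simp only: if_True)
    next
      case False
      then have "{R \<in> ?Z. R \<subseteq> e} = {}"
        using card_mono[of "e \<inter> S"] fe by (fastforce simp: saturated_def)
      then have "card {R \<in> ?Z. R \<subseteq> e} = 0"
        by (simp only: card.empty)
      then show ?thesis by (simp only: le0)
    qed
  qed
  have "d * card ?Z = (\<Sum>R\<in>?Z. d)"
    by simp
  also have "\<dots> \<le> (\<Sum>R\<in>?Z. degree E R)"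
    by (intro sum_mono) (auto simp: saturated_def)
  also have "\<dots> = (\<Sum>e\<in>E. card {R \<in> ?Z. R \<subseteq> e})"
    unfolding degree_def using sum_multicount_gen[of ?Z E "(\<subseteq>)" "\<lambda>e. card {R \<in> ?Z. R \<subseteq> e}"] fZ \<open>finite E\<close>
    by simp
  also have "\<dots> \<le> (\<Sum>e\<in>E. if r \<le> card (e \<inter> S) then r + 1 else 0)"
    by (intro sum_mono le)
  also have "\<dots> = (r + 1) * card (near_edges r S E)"
    using \<open>finite E\<close> by (simp add: near_edges_def sum.If_cases Int_def conj_commute)
  finally show ?thesis .
qed

text \<open>A rejected set contains an \<open>r\<close>-set whose degree it would raise above
  \<open>d\<close>. One insertion raises a degree by at most one, so that \<open>r\<close>-set is
  already saturated, and the rejected set is its extension by one vertex of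
  \<open>S\<close>.\<close>

lemma card_blocked:
  assumes "finite E" "finite S" and bd: "degree_bounded r d E"
  shows "card {e. e \<subseteq> S \<and> card e = r + 1 \<and> \<not> degree_bounded r d (insert e E)}
    \<le> card (saturated r d S E) * card S" (is "card ?B \<le> _")
proof -
  have "?B \<subseteq> (\<lambda>(R, v). insert v R) ` (saturated r d S E \<times> S)"
  proof
    fix e assume e: "e \<in> ?B"
    then obtain R where R: "card R = r" "d < degree (insert e E) R"
      by (auto simp: degree_bounded_def not_le)
    have "degree E R \<le> d"
      using bd R by (auto simp: degree_bounded_def)
    have "R \<subseteq> e"
      using R(2) \<open>degree E R \<le> d\<close> degree_insert_not_subset[of R e E] by linarith
    have "d \<le> degree E R"
      using R(2) degree_insert_le[OF \<open>finite E\<close>, of e R] by linarith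
    have fe: "finite e"
      using e \<open>finite S\<close> finite_subset by auto
    have "card (e - R) = 1"
      using e R \<open>R \<subseteq> e\<close> fe by (subst card_Diff_subset) (auto intro: finite_subset)
    then obtain v where v: "e - R = {v}"
      by (auto simp: card_1_singleton_iff)
    then have "e = insert v R" "v \<in> S"
      using \<open>R \<subseteq> e\<close> e by auto
    moreover have "R \<in> saturated r d S E"
      using \<open>R \<subseteq> e\<close> e R \<open>d \<le> degree E R\<close> by (auto simp: saturated_def)
    ultimately show "e \<in> (\<lambda>(R, v). insert v R) ` (saturated r d S E \<times> S)"
      by force
  qed
  moreover have fin: "finite (saturated r d S E \<times> S)"
    using \<open>finite S\<close> by (auto simp: saturated_def intro: finite_subset[of _ "Pow S"])
  ultimately have "card ?B \<le> card ((\<lambda>(R, v). insert v R) ` (saturated r d S E \<times> S))"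
    by (intro card_mono) auto
  also have "\<dots> \<le> card (saturated r d S E \<times> S)"
    using fin by (rule card_image_le)
  finally show ?thesis by (simp add: card_cartesian_product)
qed

text \<open>From \<open>(r + 1) * (s choose (r + 1)) = (s choose r) * (s - r)\<close>, since
  \<open>2 * r \<le> s\<close> gives \<open>s \<le> 2 * (s - r)\<close>.\<close>

lemma binomial_Suc_ge:
  assumes "2 * r \<le> s"
  shows "real (s choose r) * real s \<le> 2 * (real r + 1) * real (s choose (r + 1))"
proof -
  have "(r + 1) * (s choose (r + 1)) = (s choose r) * (s - r)"
    using binomial_absorb_comp[of s r] binomial_absorption[of r s]
    by (simp add: mult.commute)
  then have "real ((r + 1) * (s choose (r + 1))) = real ((s choose r) * (s - r))"
    by (rule arg_cong)
  then have "(real r + 1) * real (s choose (r + 1)) = real (s choose r) * (real s - real r)"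
    using assms by (simp add: of_nat_diff algebra_simps)
  moreover have "real (s choose r) * real s \<le> 2 * (real (s choose r) * (real s - real r))"
    using assms mult_left_mono[of "real s" "2 * (real s - real r)" "real (s choose r)"]
    by (simp add: algebra_simps)
  ultimately show ?thesis by linarith
qed

text \<open>The threshold on near edges is tuned so that at most
  \<open>(card S choose r) / (4 * (r + 1))\<close> sets are saturated; extending each by a vertex of
  \<open>S\<close> then blocks at most half of the \<open>(r + 1)\<close>-subsets of
  \<open>S\<close>.\<close>

lemma card_unblocked:
  assumes "finite E" "finite S" "0 < d" "2 * r \<le> card S"
    and E: "\<And>e. e \<in> E \<Longrightarrow> card e = r + 1"
    and bd: "degree_bounded r d E"
    and X: "real (card (near_edges r S E)) \<le> real d * real (card S choose r) / (4 * (real r + 1)\<^sup>2)"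
  shows "real (card S choose (r + 1)) / 2
    \<le> real (card {e. e \<subseteq> S \<and> card e = r + 1 \<and> degree_bounded r d (insert e E)})"
proof -
  let ?s = "card S" and ?Z = "real (card (saturated r d S E))" and ?X = "real (card (near_edges r S E))"
  let ?B = "{e. e \<subseteq> S \<and> card e = r + 1 \<and> \<not> degree_bounded r d (insert e E)}"
  let ?G = "{e. e \<subseteq> S \<and> card e = r + 1 \<and> degree_bounded r d (insert e E)}"
  have cancel: "a * (x * y / (4 * a\<^sup>2)) = x * (y / (4 * a))" if "0 < a" for a x y :: real
    using that by (simp add: power2_eq_square)
  have "real d * ?Z \<le> (real r + 1) * ?X"
    using card_saturated[OF assms(1,2) E, of d, THEN of_nat_mono[where 'a = real]] by (simp add: algebra_simps)
  also have "\<dots> \<le> (real r + 1) * (real d * real (?s choose r) / (4 * (real r + 1)\<^sup>2))"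
    by (intro mult_left_mono X) auto
  also have "\<dots> = real d * (real (?s choose r) / (4 * (real r + 1)))"
    using cancel[of "real r + 1"] by simp
  finally have Z: "?Z \<le> real (?s choose r) / (4 * (real r + 1))"
    using \<open>0 < d\<close> by (metis mult_le_cancel_left_pos of_nat_0_less_iff)
  have "real (card ?B) \<le> ?Z * real ?s"
    using card_blocked[OF assms(1,2) bd, THEN of_nat_mono[where 'a = real]] by simp
  also have "\<dots> \<le> real (?s choose r) / (4 * (real r + 1)) * real ?s"
    by (intro mult_right_mono Z) auto
  also have "\<dots> = real (?s choose r) * real ?s / (4 * (real r + 1))"
    by simp
  also have "\<dots> \<le> 2 * (real r + 1) * real (?s choose (r + 1)) / (4 * (real r + 1))"
    by (intro divide_right_mono binomial_Suc_ge assms) auto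
  also have "\<dots> = real (?s choose (r + 1)) / 2"
    by (simp add: field_simps)
  finally have "real (card ?B) \<le> real (?s choose (r + 1)) / 2" .
  moreover have "card ?B + card ?G = card (?B \<union> ?G)"
    using \<open>finite S\<close> by (intro card_Un_disjoint[symmetric]) (auto intro: finite_subset[of _ "Pow S"])
  moreover have "?B \<union> ?G = {e. e \<subseteq> S \<and> card e = r + 1}"
    by auto
  moreover have "card {e. e \<subseteq> S \<and> card e = r + 1} = ?s choose (r + 1)"
    by (rule n_subsets[OF \<open>finite S\<close>])
  ultimately show ?thesis
    by (simp flip: of_nat_add)
qed

section \<open>Effect of one random offer\<close>

text \<open>Bounds how many offers can raise the near-edge count: each is an \<open>r\<close>-subset
  of \<open>S\<close> with one further vertex of \<open>V\<close>.\<close>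

lemma card_near_subsets:
  assumes "finite V" "S \<subseteq> V"
  shows "card (near_edges r S {e. e \<subseteq> V \<and> card e = r + 1}) \<le> (card S choose r) * card V"
proof -
  let ?D = "{R. R \<subseteq> S \<and> card R = r} \<times> V"
  have fS: "finite S"
    using assms finite_subset by auto
  have "near_edges r S {e. e \<subseteq> V \<and> card e = r + 1} \<subseteq> (\<lambda>(R, v). insert v R) ` ?D"
  proof
    fix e assume "e \<in> near_edges r S {e. e \<subseteq> V \<and> card e = r + 1}"
    then have e: "e \<subseteq> V" "card e = r + 1" "r \<le> card (e \<inter> S)"
      by (auto simp: near_edges_def)
    then obtain R where R: "R \<subseteq> e \<inter> S" "card R = r"
      by (meson obtain_subset_with_card_n)
    have "finite e"
      using e assms finite_subset by auto
    then have "card (e - R) = 1"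
      using e R by (subst card_Diff_subset) (auto intro: finite_subset)
    then obtain v where "e - R = {v}"
      by (auto simp: card_1_singleton_iff)
    then have "e = insert v R" "v \<in> V"
      using R e by auto
    with R show "e \<in> (\<lambda>(R, v). insert v R) ` ?D"
      by force
  qed
  moreover have fin: "finite ?D"
    using fS assms by auto
  ultimately have "card (near_edges r S {e. e \<subseteq> V \<and> card e = r + 1}) \<le> card ((\<lambda>(R, v). insert v R) ` ?D)"
    by (intro card_mono) auto
  also have "\<dots> \<le> card ?D"
    using fin by (rule card_image_le)
  finally show ?thesis
    by (simp add: card_cartesian_product n_subsets[OF fS])
qed

text \<open>An offer raises the near-edge count by at most one, so it at most doubles the power of
  two, and it leaves the count alone unless it is near \<open>S\<close>. Division by
  \<open>card A\<close> turns this into a bound on the expected growth in one step.\<close>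

lemma sum_power_near_edges_step:
  fixes r d :: nat
  assumes "finite V" "S \<subseteq> V" "finite E"
  defines "A \<equiv> {e. e \<subseteq> V \<and> card e = r + 1}"
  shows "(\<Sum>e\<in>A. 2 ^ card (near_edges r S (greedy_step r d e E)))
    \<le> (real (card A) + real (card S choose r) * real (card V)) * 2 ^ card (near_edges r S E)"
proof -
  let ?x = "card (near_edges r S E)"
  have fA: "finite A"
    using assms by simp
  have le: "(2::real) ^ card (near_edges r S (greedy_step r d e E))
    \<le> 2 ^ ?x + (if r \<le> card (e \<inter> S) then 2 ^ ?x else 0)" for e
  proof -
    have fX: "finite (near_edges r S E)"
      using assms by (simp add: near_edges_def)
    have "near_edges r S (greedy_step r d e E) \<subseteq>
      (if r \<le> card (e \<inter> S) then insert e (near_edges r S E) else near_edges r S E)"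
      by (auto simp: greedy_step_def near_edges_def)
    then have "card (near_edges r S (greedy_step r d e E)) \<le>
      card (if r \<le> card (e \<inter> S) then insert e (near_edges r S E) else near_edges r S E)"
      using fX by (intro card_mono) auto
    also have "\<dots> \<le> (if r \<le> card (e \<inter> S) then Suc ?x else ?x)"
      using fX by (auto simp: card_insert_if)
    finally have "(2::real) ^ card (near_edges r S (greedy_step r d e E))
      \<le> 2 ^ (if r \<le> card (e \<inter> S) then Suc ?x else ?x)"
      by (rule power_increasing) simp
    then show ?thesis
      by (cases "r \<le> card (e \<inter> S)") simp_all
  qed
  have "(\<Sum>e\<in>A. (2::real) ^ card (near_edges r S (greedy_step r d e E)))
    \<le> (\<Sum>e\<in>A. 2 ^ ?x + (if r \<le> card (e \<inter> S) then 2 ^ ?x else 0))"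
    by (intro sum_mono le)
  also have "\<dots> = (real (card A) + real (card (near_edges r S A))) * 2 ^ ?x"
    using fA by (simp add: sum.distrib sum.If_cases near_edges_def Int_def algebra_simps)
  also have "\<dots> \<le> (real (card A) + real (card S choose r) * real (card V)) * 2 ^ ?x"
    using card_near_subsets[OF assms(1,2), of r, THEN of_nat_mono[where 'a = real]]
    by (intro mult_right_mono) (auto simp: A_def)
  finally show ?thesis .
qed

text \<open>Both parts of \<open>P\<close> are inherited by subsets of the edge set, so
  \<open>P\<close> never returns once lost. While it holds, at least half of the
  \<open>(r + 1)\<close>-subsets of \<open>S\<close> are unblocked, and offering any of them puts an
  edge inside \<open>S\<close>.\<close>

lemma sum_independent_step:
  fixes r d :: nat
  assumes "finite V" "S \<subseteq> V" "finite E" "0 < d" "2 * r \<le> card S"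
    and E: "\<And>e. e \<in> E \<Longrightarrow> card e = r + 1"
    and bd: "degree_bounded r d E"
  defines "A \<equiv> {e. e \<subseteq> V \<and> card e = r + 1}"
    and "P \<equiv> \<lambda>F. (\<forall>e\<in>F. \<not> e \<subseteq> S) \<and>
      real (card (near_edges r S F)) \<le> real d * real (card S choose r) / (4 * (real r + 1)\<^sup>2)"
  shows "(\<Sum>e\<in>A. of_bool (P (greedy_step r d e E)))
    \<le> (real (card A) - real (card S choose (r + 1)) / 2) * of_bool (P E)"
proof -
  have fA: "finite A"
    using assms by simp
  have fS: "finite S"
    using assms finite_subset by auto
  have mono: "P E" if "P (greedy_step r d e E)" for e
  proof -
    have sub: "E \<subseteq> greedy_step r d e E" "finite (greedy_step r d e E)"
      using assms by (auto simp: greedy_step_def)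
    then have "card (near_edges r S E) \<le> card (near_edges r S (greedy_step r d e E))"
      by (intro card_mono) (auto simp: near_edges_def)
    then show ?thesis
      using that sub unfolding P_def by fastforce
  qed
  show ?thesis
  proof (cases "P E")
    case False
    then have "P (greedy_step r d e E) = False" for e
      using mono by blast
    with False show ?thesis by simp
  next
    case True
    let ?G = "{e. e \<subseteq> S \<and> card e = r + 1 \<and> degree_bounded r d (insert e E)}"
    have GA: "?G \<subseteq> A"
      using assms by auto
    have notP: "\<not> P (greedy_step r d e E)" if "e \<in> ?G" for e
      using that by (auto simp: P_def greedy_step_def)
    have "(\<Sum>e\<in>A. of_bool (P (greedy_step r d e E))) \<le> (\<Sum>e\<in>A. if e \<in> ?G then 0 else (1::real))"
      using notP by (intro sum_mono) auto
    also have "\<dots> = real (card (A - ?G))"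
      using fA by (simp add: sum.If_cases Diff_eq)
    also have "\<dots> = real (card A) - real (card ?G)"
      using GA fA card_mono[OF fA GA] finite_subset[OF GA fA]
      by (subst card_Diff_subset) (auto simp: of_nat_diff)
    also have "\<dots> \<le> real (card A) - real (card S choose (r + 1)) / 2"
      using card_unblocked[OF \<open>finite E\<close> fS \<open>0 < d\<close> \<open>2 * r \<le> card S\<close> E bd] True
      by (auto simp: P_def)
    finally show ?thesis
      using True by simp
  qed
qed

section \<open>Potential function and union bound\<close>

text \<open>The method of conditional expectations, in place of a probability space: if the average
  of the next potential over all offers is at most the present potential, some offer does not
  increase it. The invariant \<open>I\<close> carries the facts on which the averaging bound
  depends.\<close>

lemma averaging_process:
  fixes \<Phi> :: "nat \<Rightarrow> 'b \<Rightarrow> real"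
  assumes "finite A" "A \<noteq> {}" "I x0"
    and I: "\<And>x a. I x \<Longrightarrow> a \<in> A \<Longrightarrow> I (f a x)"
    and avg: "\<And>t x. I x \<Longrightarrow> (\<Sum>a\<in>A. \<Phi> (Suc t) (f a x)) \<le> real (card A) * \<Phi> t x"
  shows "\<exists>x. I x \<and> \<Phi> t x \<le> \<Phi> 0 x0"
proof (induction t)
  case 0
  then show ?case using \<open>I x0\<close> by auto
next
  case (Suc t)
  then obtain x where x: "I x" "\<Phi> t x \<le> \<Phi> 0 x0" by auto
  have "\<exists>a\<in>A. \<Phi> (Suc t) (f a x) \<le> \<Phi> t x"
  proof (rule ccontr)
    assume "\<not> ?thesis"
    then have "(\<Sum>a\<in>A. \<Phi> t x) < (\<Sum>a\<in>A. \<Phi> (Suc t) (f a x))"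
      using assms(1,2) by (intro sum_strict_mono) auto
    with avg[OF x(1), of t] show False by simp
  qed
  with x I show ?case by (metis order_trans)
qed

text \<open>Here \<open>p\<close> is the rate at which a still independent \<open>S\<close> is hit,
  \<open>q\<close> bounds the rate at which near edges of \<open>S\<close> arrive, and
  \<open>M\<close> is the threshold of \<open>card_unblocked\<close>. The last two hypotheses say
  that a single bad \<open>S\<close>, of either kind, would outweigh the whole initial
  potential.\<close>

lemma exists_degree_bounded_covering:
  fixes V :: "'a set" and r d s T :: nat
  assumes "finite V" "r + 1 \<le> card V" "0 < d" "2 * r \<le> s"
  defines "N \<equiv> real (card V choose (r + 1))"
  defines "p \<equiv> real (s choose (r + 1)) / (2 * N)"
    and "q \<equiv> real (s choose r) * real (card V) / N"
    and "M \<equiv> real d * real (s choose r) / (4 * (real r + 1)\<^sup>2)"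
  assumes p: "2 * real (card V choose s) < exp (p * real T)"
    and q: "2 * real (card V choose s) < 2 powr M * exp (- q * real T)"
  shows "\<exists>E. (\<forall>e\<in>E. e \<subseteq> V \<and> card e = r + 1) \<and> degree_bounded r d E \<and>
    (\<forall>S. S \<subseteq> V \<and> card S = s \<longrightarrow> (\<exists>e\<in>E. e \<subseteq> S))"
proof -
  let ?A = "{e. e \<subseteq> V \<and> card e = r + 1}"
  let ?\<S> = "{S. S \<subseteq> V \<and> card S = s}"
  define P where "P S F \<longleftrightarrow> (\<forall>e\<in>F. \<not> e \<subseteq> S) \<and> real (card (near_edges r S F)) \<le> M"
    for S :: "'a set" and F
  \<comment> \<open>No term grows on average: \<open>P\<close> survives a step with probability at
    most \<open>1 - p \<le> exp (- p)\<close>, the mean of the power of two grows by a factor of at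
    most \<open>1 + q \<le> exp q\<close>, and the exponential weights offset both.\<close>
  define \<Phi> where "\<Phi> t E = (\<Sum>S\<in>?\<S>. exp (p * real t) * of_bool (P S E)
    + exp (- q * real t) * 2 ^ card (near_edges r S E))" for t E
  let ?I = "\<lambda>E. E \<subseteq> ?A \<and> degree_bounded r d E"
  have cA: "real (card ?A) = N"
    using n_subsets[OF \<open>finite V\<close>] by (simp add: N_def)
  have N: "0 < N"
    using assms(2) by (simp add: N_def zero_less_binomial_iff)
  have fA: "finite ?A" and fS: "finite ?\<S>"
    using \<open>finite V\<close> by auto
  have avg: "(\<Sum>a\<in>?A. \<Phi> (Suc t) (greedy_step r d a E)) \<le> real (card ?A) * \<Phi> t E" if "?I E" for t E
  proof -
    have fE: "finite E" and E: "\<And>e. e \<in> E \<Longrightarrow> card e = r + 1" and bd: "degree_bounded r d E"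
      using that finite_subset[OF _ fA] by auto
    have bound: "(\<Sum>a\<in>?A. exp (p * real (Suc t)) * of_bool (P S (greedy_step r d a E))
        + exp (- q * real (Suc t)) * 2 ^ card (near_edges r S (greedy_step r d a E)))
      \<le> N * (exp (p * real t) * of_bool (P S E) + exp (- q * real t) * 2 ^ card (near_edges r S E))"
      if "S \<in> ?\<S>" for S
    proof -
      have S: "S \<subseteq> V" "card S = s" using that by auto
      have "(\<Sum>a\<in>?A. of_bool (P S (greedy_step r d a E))) \<le> (N - real (s choose (r + 1)) / 2) * of_bool (P S E)"
        using sum_independent_step[OF \<open>finite V\<close> S(1) fE \<open>0 < d\<close> _ E bd] \<open>2 * r \<le> s\<close> S cA
        by (simp add: P_def M_def)
      also have "\<dots> = N * ((1 - p) * of_bool (P S E))"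
        using N by (simp add: p_def field_simps)
      also have "\<dots> \<le> N * (exp (- p) * of_bool (P S E))"
        using N exp_ge_add_one_self[of "- p"] by (intro mult_left_mono mult_right_mono) auto
      finally have "exp (p * real (Suc t)) * (\<Sum>a\<in>?A. of_bool (P S (greedy_step r d a E)))
        \<le> exp (p * real (Suc t)) * (N * (exp (- p) * of_bool (P S E)))"
        by (intro mult_left_mono) auto
      also have "\<dots> = N * ((exp (p * real (Suc t)) * exp (- p)) * of_bool (P S E))"
        by (simp only: mult_ac)
      also have "exp (p * real (Suc t)) * exp (- p) = exp (p * real t)"
        by (simp add: algebra_simps flip: exp_add)
      finally have 1: "exp (p * real (Suc t)) * (\<Sum>a\<in>?A. of_bool (P S (greedy_step r d a E)))
        \<le> N * (exp (p * real t) * of_bool (P S E))" .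
      let ?X = "2 ^ card (near_edges r S E) :: real"
      have "(\<Sum>a\<in>?A. 2 ^ card (near_edges r S (greedy_step r d a E)))
        \<le> (N + real (s choose r) * real (card V)) * ?X"
        using sum_power_near_edges_step[OF \<open>finite V\<close> S(1) fE, of r d] S cA by simp
      also have "\<dots> = N * ((1 + q) * ?X)"
        using N by (simp add: q_def field_simps)
      also have "\<dots> \<le> N * (exp q * ?X)"
        using N exp_ge_add_one_self[of q] by (intro mult_left_mono mult_right_mono) auto
      finally have "exp (- q * real (Suc t)) * (\<Sum>a\<in>?A. 2 ^ card (near_edges r S (greedy_step r d a E)))
        \<le> exp (- q * real (Suc t)) * (N * (exp q * ?X))"
        by (intro mult_left_mono) auto
      also have "\<dots> = N * ((exp (- q * real (Suc t)) * exp q) * ?X)"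
        by (simp only: mult_ac)
      also have "exp (- q * real (Suc t)) * exp q = exp (- q * real t)"
        by (simp add: algebra_simps flip: exp_add)
      finally have 2: "exp (- q * real (Suc t)) * (\<Sum>a\<in>?A. 2 ^ card (near_edges r S (greedy_step r d a E)))
        \<le> N * (exp (- q * real t) * ?X)" .
      show ?thesis
        using add_mono[OF 1 2] by (simp only: sum.distrib sum_distrib_left distrib_left)
    qed
    have "(\<Sum>a\<in>?A. \<Phi> (Suc t) (greedy_step r d a E)) =
      (\<Sum>S\<in>?\<S>. \<Sum>a\<in>?A. exp (p * real (Suc t)) * of_bool (P S (greedy_step r d a E))
        + exp (- q * real (Suc t)) * 2 ^ card (near_edges r S (greedy_step r d a E)))"
      unfolding \<Phi>_def by (rule sum.swap)
    also have "\<dots> \<le> (\<Sum>S\<in>?\<S>. N * (exp (p * real t) * of_bool (P S E)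
        + exp (- q * real t) * 2 ^ card (near_edges r S E)))"
      by (intro sum_mono bound)
    also have "\<dots> = real (card ?A) * \<Phi> t E"
      by (simp only: cA \<Phi>_def sum_distrib_left)
    finally show ?thesis .
  qed
  have "?A \<noteq> {}"
    using N by (metis cA card.empty less_irrefl of_nat_0)
  moreover have "?I {}"
    by (auto simp: degree_bounded_def degree_def)
  moreover have "?I (greedy_step r d a E)" if "?I E" "a \<in> ?A" for a E
    using that by (auto simp: greedy_step_def)
  ultimately have "\<exists>E. ?I E \<and> \<Phi> T E \<le> \<Phi> 0 {}"
    by (intro averaging_process[where f = "greedy_step r d" and A = ?A] fA avg)
  then obtain E where E: "?I E" "\<Phi> T E \<le> \<Phi> 0 {}"
    by blast
  \<comment> \<open>Without edges both terms of a summand are at most 1.\<close>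
  have "\<Phi> 0 {} \<le> (\<Sum>S\<in>?\<S>. 2)"
    unfolding \<Phi>_def by (intro sum_mono) (auto simp: near_edges_def)
  also have "\<dots> = 2 * real (card V choose s)"
    using n_subsets[OF \<open>finite V\<close>] by simp
  finally have small: "\<Phi> T E \<le> 2 * real (card V choose s)"
    using E by simp
  have cover: "\<exists>e\<in>E. e \<subseteq> S" if S: "S \<subseteq> V" "card S = s" for S
  proof (rule ccontr)
    assume indep: "\<not> (\<exists>e\<in>E. e \<subseteq> S)"
    let ?w = "exp (p * real T) * of_bool (P S E) + exp (- q * real T) * 2 ^ card (near_edges r S E)"
    have w: "?w \<le> \<Phi> T E"
      unfolding \<Phi>_def using S fS by (intro member_le_sum[where i = S]) auto
    show False
    \<comment> \<open>An uncovered \<open>S\<close> with few near edges satisfies \<open>P\<close>,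
      so its first term is too large; with many near edges its second term is.\<close>
    proof (cases "real (card (near_edges r S E)) \<le> M")
      case True
      then have "P S E" using indep by (auto simp: P_def)
      then have "exp (p * real T) \<le> ?w" by simp
      with w small p show False by linarith
    next
      case False
      then have "2 powr M \<le> 2 powr real (card (near_edges r S E))"
        by (intro powr_mono) auto
      then have "2 powr M * exp (- q * real T) \<le> exp (- q * real T) * 2 ^ card (near_edges r S E)"
        by (simp add: powr_realpow)
      also have "\<dots> \<le> ?w" by simp
      finally show False using w small q by linarith
    qed
  qed
  show ?thesis
  proof (intro exI[of _ E] conjI allI impI)
    show "\<forall>e\<in>E. e \<subseteq> V \<and> card e = r + 1" "degree_bounded r d E"
      using E(1) by auto
  qed (rule cover, auto)
qed

section \<open>Exact maximum degree and independence number\<close>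

text \<open>Take an inclusion-maximal extension. If no \<open>r\<close>-set had degree exactly
  \<open>d\<close>, all would have room for one more edge; an \<open>r\<close>-set has
  \<open>card V - r > d\<close> one-vertex extensions, so one of them is missing and could be added,
  against maximality.\<close>

lemma extend_to_exact_degree:
  assumes "finite V" "r + d < card V"
    and E: "\<forall>e\<in>E. e \<subseteq> V \<and> card e = r + 1" "degree_bounded r d E"
  shows "\<exists>E'. E \<subseteq> E' \<and> (\<forall>e\<in>E'. e \<subseteq> V \<and> card e = r + 1) \<and> degree_bounded r d E' \<and>
    (\<exists>R. R \<subseteq> V \<and> card R = r \<and> degree E' R = d)"
proof -
  let ?A = "{e. e \<subseteq> V \<and> card e = r + 1}"
  let ?F = "{F. F \<subseteq> ?A \<and> degree_bounded r d F}"
  have fA: "finite ?A" using \<open>finite V\<close> by simp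
  have "finite ?F" by (rule finite_subset[of _ "Pow ?A"]) (use fA in auto)
  moreover have "E \<in> ?F" using E by auto
  ultimately obtain E' where E': "E' \<in> ?F" "E \<subseteq> E'" and max: "\<And>F. F \<in> ?F \<Longrightarrow> E' \<subseteq> F \<Longrightarrow> E' = F"
    using finite_has_maximal2 by (metis (no_types, lifting))
  have fE': "finite E'" using E' fA finite_subset by auto
  have "\<exists>R. R \<subseteq> V \<and> card R = r \<and> degree E' R = d"
  proof (rule ccontr)
    assume *: "\<not> ?thesis"
    then have lt: "degree E' R < d" if "R \<subseteq> V" "card R = r" for R
      using that E' by (auto simp: degree_bounded_def order.strict_iff_order)
    obtain R where R: "R \<subseteq> V" "card R = r"
      using obtain_subset_with_card_n[of r V] assms(2) by auto
    have fR: "finite R" using R \<open>finite V\<close> finite_subset by auto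
    let ?J = "(\<lambda>v. insert v R) ` (V - R)"
    have "card ?J = card (V - R)"
      by (intro card_image) (auto simp: inj_on_def)
    also have "\<dots> = card V - r"
      using R fR by (simp add: card_Diff_subset)
    finally have "degree E' R < card ?J"
      using lt[OF R] assms(2) by simp
    then have "\<not> ?J \<subseteq> {e \<in> E'. R \<subseteq> e}"
      unfolding degree_def using card_mono[of "{e \<in> E'. R \<subseteq> e}" ?J] fE' by auto
    then obtain v where v: "v \<in> V - R" "insert v R \<notin> E'" by blast
    let ?e = "insert v R"
    have "degree_bounded r d (insert ?e E')"
      unfolding degree_bounded_def
    proof (intro allI impI)
      fix Q :: "'a set" assume Q: "card Q = r"
      show "degree (insert ?e E') Q \<le> d"
      proof (cases "Q \<subseteq> ?e")
        case True
        then have "degree E' Q < d"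
          using lt[of Q] Q v R by auto
        moreover have "degree (insert ?e E') Q \<le> degree E' Q + 1"
          using degree_insert_le[OF fE'] .
        ultimately show ?thesis by simp
      next
        case False
        then show ?thesis
          using E' Q by (simp add: degree_insert_not_subset degree_bounded_def)
      qed
    qed
    moreover have "?e \<in> ?A"
      using v R fR by auto
    ultimately have "insert ?e E' \<in> ?F"
      using E' by blast
    then show False
      using max[of "insert ?e E'"] v by blast
  qed
  with E' show ?thesis by blast
qed

lemma max_degree_eqI:
  assumes "finite V" "degree_bounded r d E" "R \<subseteq> V" "card R = r" "degree E R = d"
  shows "max_degree r V E = d"
  unfolding max_degree_def
proof (rule Max_eqI)
  have "{degree E R |R. R \<subseteq> V \<and> card R = r} \<subseteq> degree E ` Pow V" by auto
  then show "finite {degree E R |R. R \<subseteq> V \<and> card R = r}"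
    using \<open>finite V\<close> finite_subset by fast
qed (use assms in \<open>auto simp: degree_bounded_def\<close>)

lemma independence_number_less:
  assumes "finite V" "{} \<notin> E" and S: "\<And>S. S \<subseteq> V \<Longrightarrow> card S = s \<Longrightarrow> \<exists>e\<in>E. e \<subseteq> S"
  shows "independence_number V E < s"
  unfolding independence_number_def
proof (subst Max_less_iff)
  have "{card I |I. independent_set V E I} \<subseteq> card ` Pow V"
    by (auto simp: independent_set_def)
  then show "finite {card I |I. independent_set V E I}"
    using \<open>finite V\<close> finite_subset by fast
  \<comment> \<open>As no edge is empty, the maximum is taken over a nonempty set.\<close>
  have "independent_set V E {}"
    using \<open>{} \<notin> E\<close> by (auto simp: independent_set_def)
  then show "{card I |I. independent_set V E I} \<noteq> {}" by blast
  have "card I < s" if I: "independent_set V E I" for I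
  proof (rule ccontr)
    assume "\<not> card I < s"
    then obtain S where "S \<subseteq> I" "card S = s"
      using obtain_subset_with_card_n[of s I] by auto
    with S[of S] I show False
      by (fastforce simp: independent_set_def)
  qed
  then show "\<forall>a\<in>{card I |I. independent_set V E I}. a < s" by auto
qed

section \<open>Choice of parameters and asymptotics\<close>

text \<open>One copy of \<open>s * ln n\<close> pays for \<open>n choose s \<le> n ^ s\<close>; the
  other is at least 1 and absorbs the factor \<open>2 < exp 1\<close>.\<close>

lemma twice_binomial_less:
  assumes "1 \<le> s" "1 \<le> ln (real n)" "2 * real s * ln (real n) \<le> x"
  shows "2 * real (n choose s) < exp x"
proof -
  have n: "0 < n" using assms(2) by (cases n) auto
  have "real (n choose s) \<le> real (n ^ s)"
    using binomial_le_pow[of s n] by (cases "s \<le> n") (simp_all add: not_le binomial_eq_0)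
  also have "\<dots> = exp (real s * ln (real n))"
    using n by (simp add: exp_of_nat_mult)
  finally have "2 * real (n choose s) \<le> 2 * exp (real s * ln (real n))" by simp
  also have "\<dots> < exp 1 * exp (real s * ln (real n))"
    using exp_lower_Taylor_quadratic[of 1] by (intro mult_strict_right_mono) auto
  also have "\<dots> = exp (1 + real s * ln (real n))" by (simp add: exp_add)
  also have "\<dots> \<le> exp x"
  proof -
    have "1 * 1 \<le> real s * ln (real n)" using assms by (intro mult_mono) auto
    then show ?thesis using assms(3) by simp
  qed
  finally show ?thesis .
qed

text \<open>In the covering lemma, \<open>s2\<close> gives the condition on \<open>p\<close> and
  \<open>s1\<close> the condition on \<open>q\<close>; the polynomial lower bound on
  \<open>n\<close> ensures that at least one offer is made.\<close>

lemma exists_hypergraph: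
  fixes r d n s :: nat
  assumes "2 \<le> r" "0 < d" "r + d < n" "16 * (real r + 1) ^ (r + 3) \<le> real n" "1 \<le> ln (real n)"
    and s1: "32 * (real r + 1) ^ (r + 2) * ln (real n) \<le> real s"
    and s2: "128 * (real r + 1) ^ (r + 3) * real n * ln (real n) \<le> real d * real s ^ r"
  shows "\<exists>(V :: nat set) E. uniform_hypergraph (r + 1) V E \<and> card V = n \<and> max_degree r V E = d \<and>
    independence_number V E < s"
proof -
  let ?a = "real r + 1" and ?V = "{..<n}"
  define N where "N = real (n choose (r + 1))"
  \<comment> \<open>Chosen so that \<open>q * \<tau> = M / 4\<close>, with \<open>q\<close> and
    \<open>M\<close> as in the covering lemma.\<close>
  define \<tau> where "\<tau> = real d * N / (16 * ?a\<^sup>2 * real n)"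
  define T where "T = nat \<lfloor>\<tau>\<rfloor>"
  have n: "0 < real n" using \<open>r + d < n\<close> by simp
  have "2 * ?a ^ 1 * 1 \<le> 32 * ?a ^ (r + 2) * ln (real n)"
    using \<open>1 \<le> ln (real n)\<close> by (intro mult_mono power_increasing) auto
  with s1 have s: "2 * r + 1 \<le> s" by (simp flip: of_nat_le_iff[where 'a = real])
  have N: "(real n / ?a) ^ (r + 1) \<le> N"
    using binomial_ge_n_over_k_pow_k[of "r + 1" n, where 'a = real] \<open>r + d < n\<close>
    by (simp add: N_def add.commute)
  then have N0: "0 < N"
    using n by (intro less_le_trans[OF _ N]) auto
  have "real n * real n \<le> real n ^ (r + 1)"
    using \<open>r \<ge> 2\<close> \<open>r + d < n\<close> power_increasing[of 2 "r + 1" "real n"] by (simp add: power2_eq_square)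
  then have "real n * real n / ?a ^ (r + 1) \<le> N"
    by (intro order_trans[OF _ N]) (simp add: power_divide divide_right_mono)
  moreover have "16 * ?a\<^sup>2 * ?a ^ (r + 1) \<le> real n"
    using assms(4) by (simp add: power_add power2_eq_square power3_eq_cube algebra_simps)
  then have "(16 * ?a\<^sup>2 * ?a ^ (r + 1)) * real n / ?a ^ (r + 1) \<le> real n * real n / ?a ^ (r + 1)"
    by (intro divide_right_mono mult_right_mono) auto
  moreover have "(16 * ?a\<^sup>2 * ?a ^ (r + 1)) * real n / ?a ^ (r + 1) = 16 * ?a\<^sup>2 * real n"
    by simp
  ultimately have "16 * ?a\<^sup>2 * real n \<le> N"
    by linarith
  also have "\<dots> \<le> real d * N"
    using N0 \<open>0 < d\<close> by simp
  finally have "1 \<le> \<tau>"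
    using n by (simp add: \<tau>_def)
  \<comment> \<open>Since \<open>\<tau>\<close> is at least 1, rounding down loses at most a factor
    2.\<close>
  then have "1 \<le> \<lfloor>\<tau>\<rfloor>" "real T = of_int \<lfloor>\<tau>\<rfloor>"
    by (simp_all add: T_def)
  then have T: "real T \<le> \<tau>" "\<tau> / 2 \<le> real T"
    by linarith+
  have p: "2 * real (card ?V choose s) < exp (real (s choose (r + 1)) / (2 * N) * real T)"
  proof -
    have "2 * real s * ln (real n) = real s * (128 * ?a ^ (r + 3) * real n * ln (real n)) / (64 * ?a ^ (r + 3) * real n)"
      using n by (simp add: field_simps)
    also have "\<dots> \<le> real s * (real d * real s ^ r) / (64 * ?a ^ (r + 3) * real n)"
      by (intro divide_right_mono mult_left_mono s2) auto
    also have "\<dots> = (real s / ?a) ^ (r + 1) * (real d / (64 * ?a\<^sup>2 * real n))"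
      using n by (simp add: power_divide power_add power2_eq_square power3_eq_cube field_simps)
    also have "\<dots> \<le> real (s choose (r + 1)) * (real d / (64 * ?a\<^sup>2 * real n))"
      using binomial_ge_n_over_k_pow_k[of "r + 1" s, where 'a = real] s \<open>r \<ge> 2\<close>
      by (intro mult_right_mono) (simp_all add: add.commute)
    also have "\<dots> = real (s choose (r + 1)) / (2 * N) * (\<tau> / 2)"
      using n N0 by (simp add: \<tau>_def field_simps)
    also have "\<dots> \<le> real (s choose (r + 1)) / (2 * N) * real T"
      using N0 T by (intro mult_left_mono) auto
    finally show ?thesis
      using s \<open>1 \<le> ln (real n)\<close> by (simp only: card_lessThan) (intro twice_binomial_less, auto)
  qed
  define M where "M = real d * real (s choose r) / (4 * ?a\<^sup>2)"
  have q: "2 * real (card ?V choose s) < 2 powr M * exp (- (real (s choose r) * real (card ?V) / N) * real T)"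
  proof -
    have "real (s choose r) * real n / N * real T \<le> real (s choose r) * real n / N * \<tau>"
      using T N0 by (intro mult_left_mono) auto
    also have "\<dots> = M / 4"
      using n N0 by (simp add: \<tau>_def M_def field_simps)
    finally have qT: "real (s choose r) * real n / N * real T \<le> M / 4" .
    have "2 * real s * ln (real n) = real s * (32 * ?a ^ (r + 2) * ln (real n)) / (16 * ?a ^ (r + 2))"
      by simp
    also have "\<dots> \<le> real s * real s / (16 * ?a ^ (r + 2))"
      by (intro divide_right_mono mult_left_mono s1) auto
    \<comment> \<open>Here \<open>2 \<le> r\<close> enters, through
      \<open>s ^ 2 \<le> s ^ r\<close>.\<close>
    also have "\<dots> \<le> real s ^ r / (16 * ?a ^ (r + 2))"
      using s \<open>r \<ge> 2\<close> power_increasing[of 2 r "real s"]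
      by (intro divide_right_mono) (auto simp: power2_eq_square)
    also have "\<dots> = (real s / ?a) ^ r / (16 * ?a\<^sup>2)"
      by (simp add: power_divide power_add power2_eq_square)
    also have "\<dots> \<le> (real s / real r) ^ r / (16 * ?a\<^sup>2)"
      using \<open>r \<ge> 2\<close> by (intro divide_right_mono power_mono divide_left_mono) auto
    also have "\<dots> \<le> real (s choose r) / (16 * ?a\<^sup>2)"
      using binomial_ge_n_over_k_pow_k[of r s, where 'a = real] s by (intro divide_right_mono) auto
    also have "\<dots> \<le> real d * real (s choose r) / (16 * ?a\<^sup>2)"
      using \<open>0 < d\<close> mult_right_mono[of 1 "real d" "real (s choose r)"] by (intro divide_right_mono) auto
    also have "\<dots> = M / 4"
      by (simp add: M_def)
    finally have M: "2 * real s * ln (real n) \<le> M / 4" .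
    have "0 \<le> M" by (simp add: M_def)
    \<comment> \<open>Thus \<open>M * ln 2\<close> is at least \<open>M / 2\<close>; the decay
      factor costs at most \<open>M / 4\<close>, and the remaining \<open>M / 4\<close> covers
      \<open>2 * s * ln n\<close>.\<close>
    have "1 / 2 \<le> ln (2 :: real)"
      using ln_le_minus_one[of "1 / 2 :: real"] by (simp add: ln_div)
    then have "M * (1 / 2) \<le> M * ln 2"
      using \<open>0 \<le> M\<close> by (rule mult_left_mono)
    with M qT have "2 * real s * ln (real n) \<le> M * ln 2 - real (s choose r) * real n / N * real T"
      by simp
    then have "2 * real (n choose s) < exp (M * ln 2 - real (s choose r) * real n / N * real T)"
      using s \<open>1 \<le> ln (real n)\<close> by (intro twice_binomial_less) auto
    then show ?thesis
      by (simp add: powr_def exp_diff exp_minus field_simps)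
  qed
  obtain E where E: "\<forall>e\<in>E. e \<subseteq> ?V \<and> card e = r + 1" "degree_bounded r d E"
    and cov: "\<forall>S. S \<subseteq> ?V \<and> card S = s \<longrightarrow> (\<exists>e\<in>E. e \<subseteq> S)"
    using exists_degree_bounded_covering[of ?V r d s T] p q \<open>0 < d\<close> \<open>r + d < n\<close> s
    by (auto simp: N_def M_def)
  obtain E' R where E': "E \<subseteq> E'" "\<forall>e\<in>E'. e \<subseteq> ?V \<and> card e = r + 1" "degree_bounded r d E'"
    and R: "R \<subseteq> ?V" "card R = r" "degree E' R = d"
    using extend_to_exact_degree[of ?V r d E] E \<open>r + d < n\<close> by auto
  have "uniform_hypergraph (r + 1) ?V E'"
    using E' by (simp add: uniform_hypergraph_def)
  moreover have "max_degree r ?V E' = d"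
    using max_degree_eqI[of ?V] E' R by simp
  moreover have "independence_number ?V E' < s"
  proof (rule independence_number_less)
    show "{} \<notin> E'"
      using E'(2) by fastforce
    show "\<exists>e\<in>E'. e \<subseteq> S" if "S \<subseteq> ?V" "card S = s" for S
      using cov that E'(1) by blast
  qed simp
  ultimately show ?thesis
    by (intro exI[of _ ?V] exI[of _ E'] conjI card_lessThan)
qed

text \<open>Rounding up the \<open>r\<close>-th root of \<open>(C / d) * n * ln n\<close> gives an
  \<open>s\<close> that meets \<open>s2\<close>, and every sufficiently large \<open>n\<close> then
  works.\<close>

theorem mainTheorem2:
  fixes r :: nat
  assumes "r \<ge> 2"
  shows "\<exists>b::real. b > 0 \<and>
    (\<forall>d::nat. d > 0 \<longrightarrow>
      infinite {n::nat. \<exists>(V :: nat set) (E :: nat set set).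
        uniform_hypergraph (r + 1) V E \<and> card V = n \<and> max_degree r V E = d \<and>
        real (independence_number V E)
          \<le> b * ((real n / real d) * ln (real n / real d)) powr (1 / real r)})"
proof -
  define C where "C = 128 * (real r + 1) ^ (r + 3)"
  have C: "0 < C" by (simp add: C_def add_nonneg_pos)
  \<comment> \<open>The factor 2 pays for replacing \<open>ln n\<close> by
    \<open>2 * ln (n / d)\<close>.\<close>
  let ?b = "(2 * C) powr (1 / real r)"
  show ?thesis
  proof (intro exI[of _ ?b] conjI allI impI)
    show "0 < ?b" using C by simp
    fix d :: nat assume d: "d > 0"
    let ?Q = "\<lambda>n. \<exists>(V :: nat set) (E :: nat set set).
        uniform_hypergraph (r + 1) V E \<and> card V = n \<and> max_degree r V E = d \<and>
        real (independence_number V E) \<le> ?b * ((real n / real d) * ln (real n / real d)) powr (1 / real r)"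
    define c where "c = 32 * (real r + 1) ^ (r + 2)"
    define k where "k = C / real d"
    have k: "k > 0" using C d by (simp add: k_def)
    have e1: "eventually (\<lambda>n. r + d < n) sequentially"
      by (rule eventually_gt_at_top)
    have e2: "eventually (\<lambda>n. 16 * (real r + 1) ^ (r + 3) \<le> real n) sequentially"
      by real_asymp
    have e3: "eventually (\<lambda>n. 1 \<le> ln (real n)) sequentially"
      by real_asymp
    \<comment> \<open>A positive power of \<open>n\<close> outgrows \<open>ln n\<close>; this
      supplies \<open>s1\<close>.\<close>
    have e4: "eventually (\<lambda>n. c * ln (real n) \<le> (k * real n * ln (real n)) powr (1 / real r)) sequentially"
      using k \<open>r \<ge> 2\<close> by real_asymp
    \<comment> \<open>Once \<open>n\<close> is at least \<open>d ^ 2\<close>, \<open>ln n\<close> is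
      at most \<open>2 * ln (n / d)\<close>.\<close>
    have e5: "eventually (\<lambda>n. real d ^ 2 \<le> real n) sequentially"
      by real_asymp
    have "eventually ?Q sequentially"
      using e1 e2 e3 e4 e5
    proof eventually_elim
      case (elim n)
      let ?x = "(k * real n * ln (real n)) powr (1 / real r)"
      let ?Y = "(real n / real d) * ln (real n / real d)"
      define s where "s = nat \<lceil>?x\<rceil>"
      have s: "?x \<le> real s" "real s < ?x + 1"
        unfolding s_def by (auto simp: ceiling_less_iff le_of_int_ceiling) linarith+
      have y: "0 < k * real n * ln (real n)"
        using k elim \<open>r \<ge> 2\<close> by (intro mult_pos_pos) auto
      have "?x ^ r = ?x powr real r"
        using y by (intro powr_realpow[symmetric]) (simp only: powr_gt_zero less_imp_neq[symmetric] not_False_eq_True)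
      also have "\<dots> = k * real n * ln (real n)"
        unfolding powr_powr using y \<open>r \<ge> 2\<close> by simp
      finally have "k * real n * ln (real n) = ?x ^ r" ..
      also have "\<dots> \<le> real s ^ r"
        using s by (intro power_mono) auto
      finally have s2: "C * real n * ln (real n) \<le> real d * real s ^ r"
        using d by (simp add: k_def field_simps)
      have "\<exists>(V :: nat set) E. uniform_hypergraph (r + 1) V E \<and> card V = n \<and> max_degree r V E = d \<and>
          independence_number V E < s"
        using exists_hypergraph[of r d n s] assms d elim s s2 by (simp add: C_def c_def)
      then obtain V :: "nat set" and E where VE: "uniform_hypergraph (r + 1) V E" "card V = n" "max_degree r V E = d"
          "independence_number V E < s"
        by blast
      have "ln (real d ^ 2) \<le> ln (real n)"
        using elim d \<open>r \<ge> 2\<close> by (subst ln_le_cancel_iff) auto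
      then have "2 * ln (real d) \<le> ln (real n)"
        using d by (simp add: ln_realpow)
      then have "ln (real n) \<le> 2 * ln (real n / real d)"
        using d elim by (simp add: ln_div)
      then have "C * (real n / real d) * ln (real n) \<le> C * (real n / real d) * (2 * ln (real n / real d))"
        using C by (intro mult_left_mono) auto
      then have le: "k * real n * ln (real n) \<le> 2 * C * ?Y"
        by (simp add: k_def mult_ac)
      \<comment> \<open>The strict bound cancels the rounding: the independence number plus 1 is at
        most \<open>s\<close>, and \<open>s < ?x + 1\<close>.\<close>
      have "real (independence_number V E) \<le> ?x"
        using VE(4) s(2) by linarith
      also have "\<dots> \<le> (2 * C * ?Y) powr (1 / real r)"
        using le y by (intro powr_mono2) auto
      also have "\<dots> = ?b * ?Y powr (1 / real r)"
        by (rule powr_mult)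
      finally have "real (independence_number V E) \<le> ?b * ?Y powr (1 / real r)" .
      with VE(1-3) show ?case
        by (intro exI[of _ V] exI[of _ E] conjI)
    qed
    then have "frequently ?Q cofinite"
      unfolding cofinite_eq_sequentially by (rule eventually_frequently[rotated]) simp
    then show "infinite {n. ?Q n}"
      unfolding frequently_cofinite .
  qed
qed

end
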